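(* Consider four lower-semicontinuous functions $f,g,l,u\colon\mathbb{R}^d\to\overline{\mathbb{R}}$, a real $\rho\ge0$, and a pair $(x,v)\in\mathrm{gph}\,\partial g$. Suppose that $l$ is locally Lipschitz continuous and that the conditions $$l(y)\le f(y)-g(y)\le u(y)\qquad\text{and}\qquad g(y)\ge g(x)+\langle v,y-x\rangle-\frac\rho2\|y-x\|^2$$ hold for all points $y\in\mathbb{R}^d$. Then for any $\gamma>0$, there exists a point $\hat x$ satisfying $$\|\hat x-x\|\le2\gamma\qquad\text{and}\qquad\mathrm{dist}(v;\partial f(\hat x))\le2\rho\gamma+\frac{u(x)-l(x)}{\gamma}+\mathrm{lip}(l;\hat x).$$ In particular, if $l(\cdot)$ is constant, we have the estimate $$\mathrm{dist}\Big((x,v),\mathrm{gph}\,\partial f\Big)\le\sqrt{4(\rho+\sqrt{2+\rho^2})}\cdot\sqrt{u(x)-l(x)}.$$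
   Context: $\overline{\mathbb{R}}=\mathbb{R}\cup\{\pm\infty\}$; $\|\cdot\|$ is the Euclidean norm and $\mathrm{dist}(\cdot;Q)$ the Euclidean distance to a set $Q$. For a function $f$ and a point $x$ with $f(x)$ finite, the Fréchet subdifferential $\hat\partial f(x)$ is the set of $v$ with $f(y)\ge f(x)+\langle v,y-x\rangle+o(\|y-x\|)$ as $y\to x$; the limiting subdifferential $\partial f(x)$ is the set of limits of vectors $v_i\in\hat\partial f(x_i)$ with $x_i\to x$, $f(x_i)\to f(x)$. Its graph is $\mathrm{gph}\,\partial f=\{(x,y)\in\mathbb{R}^d\times\mathbb{R}^d:y\in\partial f(x)\}$. For a function $l$ and a point $z$ with $l(z)$ finite, $\mathrm{lip}(l;z):=\limsup_{y\to z}\frac{|l(y)-l(z)|}{\|y-z\|}$. *)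

theory Defs
  imports "HOL-Analysis.Analysis" "HOL-Library.Landau_Symbols"
begin

text \<open>
  Functions into the extended reals have type \<open>'a \<Rightarrow> ereal\<close>, and \<open>'a::euclidean_space\<close> plays the
  role of \<open>\<real>\<^sup>d\<close>. The product \<open>'a \<times> 'a\<close> carries the Euclidean product norm.
\<close>

definition lsc :: "('a::euclidean_space \<Rightarrow> ereal) \<Rightarrow> bool" where
  "lsc f \<longleftrightarrow> (\<forall>x. f x \<le> Liminf (at x) f)"

text \<open>A locally Lipschitz function is in particular finite everywhere.\<close>

definition locally_lipschitz :: "('a::euclidean_space \<Rightarrow> ereal) \<Rightarrow> bool" where
  "locally_lipschitz l \<longleftrightarrow> (\<forall>x. \<bar>l x\<bar> \<noteq> \<infinity>) \<and>
     (\<forall>x. \<exists>e>0. \<exists>L. L-lipschitz_on (ball x e) (\<lambda>y. real_of_ereal (l y)))"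

text \<open>Both subdifferentials are empty at points where \<open>f\<close> is not finite.\<close>

definition frechet_subdiff :: "('a::euclidean_space \<Rightarrow> ereal) \<Rightarrow> 'a \<Rightarrow> 'a set" where
  "frechet_subdiff f x = {v. \<bar>f x\<bar> \<noteq> \<infinity> \<and>
     (\<exists>r :: 'a \<Rightarrow> real. r \<in> o[at x](\<lambda>y. norm (y - x)) \<and>
        (\<forall>\<^sub>F y in at x. f y \<ge> f x + ereal (v \<bullet> (y - x)) + ereal (r y)))}"

definition limiting_subdiff :: "('a::euclidean_space \<Rightarrow> ereal) \<Rightarrow> 'a \<Rightarrow> 'a set" where
  "limiting_subdiff f x = {v. \<bar>f x\<bar> \<noteq> \<infinity> \<and>
     (\<exists>X V. (\<forall>i::nat. V i \<in> frechet_subdiff f (X i)) \<and>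
        X \<longlonglongrightarrow> x \<and> (\<lambda>i. f (X i)) \<longlonglongrightarrow> f x \<and> V \<longlonglongrightarrow> v)}"

definition gph_limiting_subdiff :: "('a::euclidean_space \<Rightarrow> ereal) \<Rightarrow> ('a \<times> 'a) set" where
  "gph_limiting_subdiff f = {(x, y). y \<in> limiting_subdiff f x}"

definition lip :: "('a::euclidean_space \<Rightarrow> ereal) \<Rightarrow> 'a \<Rightarrow> ereal" where
  "lip l z = Limsup (at z) (\<lambda>y. \<bar>l y - l z\<bar> / ereal (norm (y - z)))"

text \<open>
  The distance to the empty set is \<open>\<infinity>\<close>; the library's \<open>infdist\<close> would give \<open>0\<close>.
\<close>

definition edist_to :: "'a::metric_space \<Rightarrow> 'a set \<Rightarrow> ereal" where
  "edist_to x Q = (INF q\<in>Q. ereal (dist x q))"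

text \<open>The square root on \<open>[0, \<infinity>]\<close>; values at negative arguments are irrelevant.\<close>

definition ereal_sqrt :: "ereal \<Rightarrow> ereal" where
  "ereal_sqrt t = (if t = \<infinity> then \<infinity> else ereal (sqrt (real_of_ereal t)))"

text \<open>
  The difference \<open>a - b\<close> of extended reals is meaningful unless \<open>a\<close> and \<open>b\<close> are the same infinity.
  On \<open>ereal\<close> subtraction is total, with \<open>\<infinity> - \<infinity> = \<infinity>\<close>.
\<close>

definition diff_defined :: "ereal \<Rightarrow> ereal \<Rightarrow> bool" where
  "diff_defined a b \<longleftrightarrow> \<not> (a = b \<and> \<bar>a\<bar> = \<infinity>)"

end

theory Submission
  imports Defs
begin

text \<open>
  With \<open>\<epsilon> = u x - l x\<close>, the function \<open>f y - l y - v \<bullet> (y - x) + \<rho> / 2 * (norm (y - x))\<^sup>2\<close> is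
  bounded below by \<open>g x\<close>, and its value at \<open>x\<close> exceeds \<open>g x\<close> by at most \<open>\<epsilon>\<close>. After adding
  \<open>c * (norm (y - x))\<^sup>2\<close> with \<open>\<epsilon> \<le> c * R\<^sup>2\<close>, it has a global minimiser \<open>xh\<close> within \<open>R\<close> of \<open>x\<close>.
  The calmness of \<open>l\<close> at \<open>xh\<close> alone then makes \<open>xh\<close> a local minimiser of \<open>f\<close> plus a
  quadratic plus \<open>L * norm (y - xh)\<close>, so no sum rule involving subgradients of \<open>- l\<close> (which
  would bring in the larger local Lipschitz modulus) is needed. The choices are \<open>R = 2 * \<gamma>\<close>,
  \<open>c = \<epsilon> / (4 * \<gamma>\<^sup>2)\<close> for the first estimate and \<open>R\<^sup>2 = 2 * \<epsilon> / sqrt (1 + \<rho>\<^sup>2)\<close>,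
  \<open>c = \<epsilon> / R\<^sup>2\<close> for the second (\<open>R = c = 0\<close> if \<open>\<epsilon> = 0\<close>).
\<close>

section \<open>Lower semicontinuity and existence of minimisers\<close>

lemma lsc_eventually_less:
  assumes "lsc f" "a < f x"
  shows "\<forall>\<^sub>F y in nhds x. a < f y"
proof -
  have "a < Liminf (at x) f"
    using assms unfolding lsc_def by (meson less_le_trans)
  then have "\<forall>\<^sub>F y in at x. a < f y"
    by (rule less_LiminfD)
  then show ?thesis
    unfolding eventually_at_filter
    by (rule eventually_mono) (metis assms(2) UNIV_I)
qed

text \<open>A real \<open>b\<close> strictly between \<open>a - ereal (h x)\<close> and
  \<open>f x\<close> separates the two terms: near \<open>x\<close>, \<open>f\<close> stays above
  \<open>b\<close> by semicontinuity and \<open>b + h y\<close> stays above \<open>a\<close> by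
  continuity. Infinite values of \<open>f\<close> then need no special treatment.\<close>

lemma lsc_add_continuous_eventually_less:
  fixes h :: "'a::euclidean_space \<Rightarrow> real"
  assumes f: "lsc f" and h: "isCont h x" and a: "a < f x + ereal (h x)"
  shows "\<forall>\<^sub>F y in nhds x. a < f y + ereal (h y)"
proof -
  have "a - ereal (h x) < f x"
    using a by (simp add: ereal_minus_less)
  then obtain b' where b': "a - ereal (h x) < b'" "b' < f x"
    using dense by blast
  then obtain b where b: "b' = ereal b"
    by (cases b') auto
  have "a < ereal (b + h x)"
    using b' b by (simp add: ereal_minus_less)
  moreover have "((\<lambda>y. ereal (b + h y)) \<longlongrightarrow> ereal (b + h x)) (nhds x)"
    using h unfolding continuous_at tendsto_at_iff_tendsto_nhds
    by (intro tendsto_intros)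
  ultimately have "\<forall>\<^sub>F y in nhds x. a < ereal (b + h y)"
    by (rule order_tendstoD(1)[rotated])
  moreover have "\<forall>\<^sub>F y in nhds x. ereal b < f y"
    using lsc_eventually_less[OF f] b' b by simp
  ultimately show ?thesis
  proof eventually_elim
    case (elim y)
    have "ereal (b + h y) \<le> f y + ereal (h y)"
      using elim(2) by (cases "f y") auto
    then show ?case using elim(1) by simp
  qed
qed

text \<open>Without a minimiser the open sets \<open>{y. F z < F y}\<close> would cover
  \<open>S\<close>. In a finite subcover, an index \<open>m\<close> with least value of
  \<open>F\<close> lies in none of the chosen sets, a contradiction.\<close>

lemma lsc_add_continuous_attains_min:
  fixes h :: "'a::euclidean_space \<Rightarrow> real"
  assumes f: "lsc f" and h: "\<And>x. isCont h x" and S: "compact S" "S \<noteq> {}"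
  obtains m where "m \<in> S" "\<And>y. y \<in> S \<Longrightarrow> f m + ereal (h m) \<le> f y + ereal (h y)"
proof -
  define F where "F y = f y + ereal (h y)" for y
  have op: "open {y. a < F y}" for a
  proof (subst open_subopen, intro ballI)
    fix x assume "x \<in> {y. a < F y}"
    then have "\<forall>\<^sub>F y in nhds x. a < F y"
      using lsc_add_continuous_eventually_less[OF f h] unfolding F_def by blast
    then show "\<exists>T. open T \<and> x \<in> T \<and> T \<subseteq> {y. a < F y}"
      unfolding eventually_nhds by blast
  qed
  have "\<exists>m\<in>S. \<forall>y\<in>S. F m \<le> F y"
  proof (rule ccontr)
    assume "\<not> ?thesis"
    then have "S \<subseteq> (\<Union>z\<in>S. {y. F z < F y})"
      by (auto simp: not_le)
    then obtain T where T: "T \<subseteq> S" "finite T" "S \<subseteq> (\<Union>z\<in>T. {y. F z < F y})"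
      using compactE_image[OF S(1), of S "\<lambda>z. {y. F z < F y}"] op by metis
    have "T \<noteq> {}" using T S by auto
    then obtain m where "m \<in> T" "\<forall>z\<in>T. F m \<le> F z"
      using T(2) by (metis arg_min_if_finite(1) arg_min_least)
    then show False using T by fastforce
  qed
  then show ?thesis using that unfolding F_def by blast
qed

section \<open>Subgradients at local minimisers\<close>

text \<open>Moving \<open>h\<close> to the other side of the minimality inequality leaves the linear
  term given by \<open>- G\<close> and the negated first-order remainder of \<open>h\<close>, which
  serves as the little-o term.\<close>

lemma local_min_imp_frechet_subdiff:
  fixes h :: "'a::euclidean_space \<Rightarrow> real"
  assumes fin: "\<bar>f x\<bar> \<noteq> \<infinity>"
    and min: "\<forall>\<^sub>F y in at x. f x + ereal (h x) \<le> f y + ereal (h y)"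
    and h: "(h has_derivative (\<lambda>d. G \<bullet> d)) (at x)"
  shows "- G \<in> frechet_subdiff f x"
proof -
  define r where "r y = - (h y - h x - G \<bullet> (y - x))" for y
  have "((\<lambda>y. norm (h y - h x - G \<bullet> (y - x)) / norm (y - x)) \<longlongrightarrow> 0) (at x)"
    using h unfolding has_derivative_iff_norm by simp
  then have "((\<lambda>y. r y / norm (y - x)) \<longlongrightarrow> 0) (at x)"
    by (subst tendsto_norm_zero_iff[symmetric])
       (simp add: r_def norm_divide del: minus_diff_eq)
  then have "r \<in> o[at x](\<lambda>y. norm (y - x))"
    by (intro smalloI_tendsto) (auto simp: eventually_at_filter)
  moreover have "\<forall>\<^sub>F y in at x. f y \<ge> f x + ereal ((- G) \<bullet> (y - x)) + ereal (r y)"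
    using min
  proof eventually_elim
    case (elim y)
    then show ?case using fin
      by (cases "f x"; cases "f y") (auto simp: r_def)
  qed
  ultimately show ?thesis
    unfolding frechet_subdiff_def using fin by blast
qed

text \<open>
  The kink \<open>K * norm (y - x)\<close> is replaced by the smooth \<open>K * sqrt ((norm (y - x))\<^sup>2 + s\<^sup>2)\<close>,
  whose gradient has norm at most \<open>K\<close>; the additional \<open>(norm (y - x))\<^sup>2\<close> forces the
  perturbed minimisers towards \<open>x\<close>.
\<close>

lemma local_min_norm_approx_frechet_subdiff:
  fixes q :: "'a::euclidean_space \<Rightarrow> real"
  assumes f: "lsc f" and fin: "\<bar>f x\<bar> \<noteq> \<infinity>"
    and q: "\<And>y. (q has_derivative (\<lambda>d. G y \<bullet> d)) (at y)"
    and K: "K \<ge> 0"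
    and min: "\<forall>\<^sub>F y in at x. f x + ereal (q x) \<le> f y + ereal (q y + K * norm (y - x))"
    and e: "e > 0"
  obtains y w where "norm (y - x) < e" "\<bar>f y\<bar> \<noteq> \<infinity>"
    "\<bar>real_of_ereal (f y) - real_of_ereal (f x)\<bar> < e"
    "w \<in> frechet_subdiff f y" "norm (w + G y) \<le> K + 2 * e"
proof -
  obtain fx where fx: "f x = ereal fx" using fin by (cases "f x") auto
  obtain r where r: "r > 0"
    and rmin: "\<And>y. norm (y - x) < r \<Longrightarrow> f x + ereal (q x) \<le> f y + ereal (q y + K * norm (y - x))"
  proof -
    obtain r where "r > 0" and
      "\<forall>y. y \<noteq> x \<and> dist y x < r \<longrightarrow> f x + ereal (q x) \<le> f y + ereal (q y + K * norm (y - x))"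
      using min unfolding eventually_at by auto
    then show thesis using that[of r]
      by (metis add_0_right diff_self dist_norm mult_zero_right norm_zero order_refl)
  qed
  have qc: "isCont q y" for y
    using q has_derivative_continuous by blast
  obtain d0 where d0: "d0 > 0" "\<And>y. norm (y - x) < d0 \<Longrightarrow> \<bar>q y - q x\<bar> < e / 4"
  proof -
    have "\<exists>d>0. \<forall>y. dist y x < d \<longrightarrow> dist (q y) (q x) < e / 4"
      using qc[of x] e unfolding continuous_at_eps_delta by (metis zero_less_divide_iff zero_less_numeral)
    then show thesis using that by (auto simp: dist_norm)
  qed
  \<comment> \<open>The halves make \<open>d < r\<close> and \<open>d < e\<close> strict;
    \<open>K + 1\<close> replaces \<open>K\<close> so that \<open>K = 0\<close> is allowed.\<close>
  define d where "d = Min {d0, r / 2, e / 2, e / (4 * (K + 1))}"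
  have d: "d > 0" "d \<le> d0" "d < r" "d < e" "d \<le> e / (4 * (K + 1))"
    using d0 r e K unfolding d_def by (auto simp: min_less_iff_disj)
  have Kd: "K * d < e / 4"
  proof -
    have "K * d < (K + 1) * d" using d by (simp add: algebra_simps)
    also have "\<dots> \<le> e / 4" using d(5) K by (simp add: field_simps)
    finally show ?thesis .
  qed
  \<comment> \<open>Smoothing the norm raises the value at \<open>x\<close> by \<open>K * s\<close>.
    Keeping this below \<open>d\<^sup>2\<close> lets the added square hold the minimiser strictly
    inside the ball of radius \<open>d\<close>.\<close>
  define s where "s = min (d\<^sup>2 / (K + 1)) d"
  have s: "s > 0" "s \<le> d" using d K by (auto simp: s_def)
  have Ks: "K * s < d\<^sup>2"
  proof -
    have "K * s < (K + 1) * s" using s by (simp add: algebra_simps)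
    also have "\<dots> \<le> (K + 1) * (d\<^sup>2 / (K + 1))" 
      using K by (intro mult_left_mono) (auto simp: s_def)
    also have "\<dots> = d\<^sup>2" using K by simp
    finally show ?thesis .
  qed
  define p where "p y = sqrt ((y - x) \<bullet> (y - x) + s\<^sup>2)" for y
  define h where "h y = q y + K * p y + (y - x) \<bullet> (y - x)" for y
  \<comment> \<open>The gradient of \<open>h\<close>; its last term, from the added square, is the
    source of the slack \<open>2 * e\<close>.\<close>
  define H where "H y = G y + (K / p y) *\<^sub>R (y - x) + 2 *\<^sub>R (y - x)" for y
  have pos: "(y - x) \<bullet> (y - x) + s\<^sup>2 > 0" for y
    using s by (simp add: add_nonneg_pos)
  then have ppos: "p y > 0" for y by (simp add: p_def)
  have pge: "norm (y - x) \<le> p y" for y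
    unfolding p_def norm_eq_sqrt_inner by simp
  have h': "(h has_derivative (\<lambda>d. H y \<bullet> d)) (at y)" for y
    unfolding h_def p_def
    by (rule derivative_eq_intros q refl pos)+
       (simp add: fun_eq_iff H_def p_def inner_add_left inner_diff_left inner_diff_right
          inner_commute algebra_simps divide_simps)
  have hc: "isCont h y" for y
    using h' has_derivative_continuous by blast
  have "cball x d \<noteq> {}" using d by simp
  then obtain y where y: "y \<in> cball x d"
    and ymin: "\<And>z. z \<in> cball x d \<Longrightarrow> f y + ereal (h y) \<le> f z + ereal (h z)"
    using lsc_add_continuous_attains_min[OF f hc compact_cball] by metis
  have hx: "h x = q x + K * s" using s by (simp add: h_def p_def)
  have yd: "norm (y - x) \<le> d" using y by (simp add: dist_norm norm_minus_commute)
  have up: "f y + ereal (h y) \<le> ereal (fx + q x + K * s)"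
    using ymin[of x] d fx hx by (simp add: add.assoc)
  have low: "ereal (fx + q x) \<le> f y + ereal (q y + K * norm (y - x))"
    using rmin[of y] yd d fx by simp
  obtain fy where fy: "f y = ereal fy"
    using up low by (cases "f y") auto
  have up': "fy + h y \<le> fx + q x + K * s" using up fy by simp
  have low': "fx + q x \<le> fy + q y + K * norm (y - x)" using low fy by simp
  have Kp: "K * norm (y - x) \<le> K * p y" using pge K by (intro mult_left_mono)
  \<comment> \<open>\<open>up'\<close> compares \<open>y\<close> with \<open>x\<close> for the
    smoothed problem, \<open>low'\<close> for the original one; chaining them cancels
    \<open>f\<close> and \<open>q\<close>.\<close>
  have "(norm (y - x))\<^sup>2 \<le> K * s"
    using up' low' Kp unfolding h_def by (simp add: power2_norm_eq_inner)
  then have "(norm (y - x))\<^sup>2 < d\<^sup>2" using Ks by simp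
  then have yd': "norm (y - x) < d"
    using d by (simp add: power2_less_imp_less)
  have q_near: "\<bar>q y - q x\<bar> < e / 4" using d0 yd' d by simp
  have "K * norm (y - x) \<le> K * d" "K * s \<le> K * d" "K * p y \<ge> 0"
    using yd s K ppos[of y] by (auto intro!: mult_left_mono)
  moreover have "(y - x) \<bullet> (y - x) \<ge> 0" by simp
  ultimately have f_near: "\<bar>fy - fx\<bar> < e"
    using up' low' Kd q_near e unfolding h_def by linarith
  \<comment> \<open>As \<open>y\<close> is interior to the ball, the constrained minimum is an
    unconstrained local one.\<close>
  have "\<forall>\<^sub>F z in at y. f y + ereal (h y) \<le> f z + ereal (h z)"
  proof -
    have "\<forall>\<^sub>F z in nhds y. z \<in> ball x d"
      using yd' by (intro eventually_nhds_in_open) (auto simp: dist_norm norm_minus_commute)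
    then have "\<forall>\<^sub>F z in nhds y. f y + ereal (h y) \<le> f z + ereal (h z)"
      by eventually_elim (auto intro!: ymin)
    then show ?thesis by (simp add: eventually_at_filter eventually_mono)
  qed
  then have w: "- H y \<in> frechet_subdiff f y"
    using h' fy by (intro local_min_imp_frechet_subdiff) auto
  have "norm (- H y + G y) = norm ((K / p y) *\<^sub>R (y - x) + 2 *\<^sub>R (y - x))"
    unfolding H_def by (metis (no_types, lifting) add.assoc add.commute add.left_inverse
        add_0 minus_add_distrib norm_minus_cancel)
  also have "\<dots> \<le> K / p y * norm (y - x) + 2 * norm (y - x)"
    using norm_triangle_ineq[of "(K / p y) *\<^sub>R (y - x)" "2 *\<^sub>R (y - x)"] K ppos[of y] by simp
  also have "K / p y * norm (y - x) \<le> K / p y * p y"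
    using pge ppos[of y] K by (intro mult_left_mono) auto
  also have "K / p y * p y = K" using ppos[of y] by simp
  finally have "norm (- H y + G y) \<le> K + 2 * e"
    using yd d by simp
  then show thesis
    using that[of y "- H y"] yd d f_near fx fy w by simp
qed

text \<open>Letting the tolerance of the approximate result tend to 0 keeps the vectors
  \<open>W n + G (X n)\<close> bounded. A convergent subsequence, together with continuity of
  \<open>G\<close>, makes the subgradients \<open>W n\<close> converge along it.\<close>

lemma local_min_norm_imp_limiting_subdiff:
  fixes q :: "'a::euclidean_space \<Rightarrow> real"
  assumes f: "lsc f" and fin: "\<bar>f x\<bar> \<noteq> \<infinity>"
    and q: "\<And>y. (q has_derivative (\<lambda>d. G y \<bullet> d)) (at y)"
    and G: "isCont G x"
    and K: "K \<ge> 0"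
    and min: "\<forall>\<^sub>F y in at x. f x + ereal (q x) \<le> f y + ereal (q y + K * norm (y - x))"
  obtains w where "w \<in> limiting_subdiff f x" "norm (w + G x) \<le> K"
proof -
  define e where "e n = inverse (real (Suc n))" for n
  have epos: "e n > 0" and e1: "e n \<le> 1" for n by (auto simp: e_def field_simps)
  have e0: "e \<longlonglongrightarrow> 0" unfolding e_def by (rule LIMSEQ_inverse_real_of_nat)
  have "\<forall>n. \<exists>y w. norm (y - x) < e n \<and> \<bar>f y\<bar> \<noteq> \<infinity> \<and>
      \<bar>real_of_ereal (f y) - real_of_ereal (f x)\<bar> < e n \<and>
      w \<in> frechet_subdiff f y \<and> norm (w + G y) \<le> K + 2 * e n"
    using local_min_norm_approx_frechet_subdiff[OF f fin q K min epos] by metis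
  then obtain X W where X: "\<And>n. norm (X n - x) < e n" and Xfin: "\<And>n. \<bar>f (X n)\<bar> \<noteq> \<infinity>"
    and fX: "\<And>n. \<bar>real_of_ereal (f (X n)) - real_of_ereal (f x)\<bar> < e n"
    and W: "\<And>n. W n \<in> frechet_subdiff f (X n)" and WG: "\<And>n. norm (W n + G (X n)) \<le> K + 2 * e n"
    by metis
  have Xlim: "X \<longlonglongrightarrow> x"
    by (rule metric_tendsto_imp_tendsto[OF e0])
       (auto simp: dist_norm intro!: eventuallyI less_imp_le[OF X] order_trans[OF less_imp_le[OF X]])
  have "(\<lambda>n. real_of_ereal (f (X n))) \<longlonglongrightarrow> real_of_ereal (f x)"
    by (rule metric_tendsto_imp_tendsto[OF e0])
       (auto simp: dist_norm intro!: eventuallyI order_trans[OF less_imp_le[OF fX]])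
  then have "(\<lambda>n. ereal (real_of_ereal (f (X n)))) \<longlonglongrightarrow> ereal (real_of_ereal (f x))"
    by (rule tendsto_ereal)
  then have fXlim: "(\<lambda>n. f (X n)) \<longlonglongrightarrow> f x"
    unfolding ereal_real'[OF Xfin] ereal_real'[OF fin] .
  have GX: "(\<lambda>n. G (X n)) \<longlonglongrightarrow> G x"
    using G Xlim by (rule isCont_tendsto_compose)
  have "\<forall>n. W n + G (X n) \<in> cball 0 (K + 2)"
  proof
    fix n show "W n + G (X n) \<in> cball 0 (K + 2)"
      using WG[of n] e1[of n] by simp
  qed
  then obtain z \<sigma> where \<sigma>: "strict_mono \<sigma>" and z: "((\<lambda>n. W n + G (X n)) \<circ> \<sigma>) \<longlonglongrightarrow> z"
    using compact_cball[of 0 "K + 2"] unfolding compact_def by meson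
  note sub = LIMSEQ_subseq_LIMSEQ[OF _ \<sigma>]
  have Wlim: "(\<lambda>n. W (\<sigma> n)) \<longlonglongrightarrow> z - G x"
    using tendsto_diff[OF z sub[OF GX]] by (simp add: o_def)
  have "(\<lambda>n. K + 2 * (e \<circ> \<sigma>) n) \<longlonglongrightarrow> K + 2 * 0"
    by (intro tendsto_intros sub e0)
  then have "norm z \<le> K + 2 * 0"
    using tendsto_norm[OF z] WG by (intro LIMSEQ_le) (auto simp: o_def)
  moreover have "z - G x \<in> limiting_subdiff f x"
    unfolding limiting_subdiff_def mem_Collect_eq
    using fin W Wlim sub[OF Xlim] sub[OF fXlim]
    by (intro conjI exI[of _ "X \<circ> \<sigma>"] exI[of _ "W \<circ> \<sigma>"]) (simp_all add: o_def)
  ultimately show thesis using that[of "z - G x"] by simp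
qed

section \<open>The perturbed minimiser and its subgradient\<close>

text \<open>The point \<open>xh\<close> is fixed before the calmness constant \<open>L\<close>. This
  order matters: \<open>L\<close> may later decrease to \<open>lip l xh\<close> while
  \<open>xh\<close> stays the same.\<close>

lemma quadratic_minorant_nearby_subgradient:
  fixes f :: "'a::euclidean_space \<Rightarrow> ereal" and l :: "'a \<Rightarrow> real"
  assumes f: "lsc f" and l: "\<And>y. isCont l y" and \<rho>: "\<rho> \<ge> 0"
    and low: "\<And>y. ereal (a + v \<bullet> (y - x) - \<rho> / 2 * (norm (y - x))\<^sup>2 + l y) \<le> f y"
    and up: "f x \<le> ereal (a + l x + \<epsilon>)"
    and c: "c \<ge> 0" "R \<ge> 0" "\<epsilon> \<le> c * R\<^sup>2"
  obtains xh where "norm (xh - x) \<le> R"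
    "\<And>L. L \<ge> 0 \<Longrightarrow> \<forall>\<^sub>F y in at xh. \<bar>l y - l xh\<bar> \<le> L * norm (y - xh) \<Longrightarrow>
       \<exists>w \<in> limiting_subdiff f xh. norm (w - v) \<le> (\<rho> + 2 * c) * R + L"
proof -
  define q where "q y = - (v \<bullet> (y - x)) + (\<rho> / 2 + c) * ((y - x) \<bullet> (y - x))" for y
  define G where "G y = - v + (\<rho> + 2 * c) *\<^sub>R (y - x)" for y
  define \<phi> where "\<phi> y = f y + ereal (q y - l y)" for y
  have q': "(q has_derivative (\<lambda>d. G y \<bullet> d)) (at y)" for y
    unfolding q_def
    by (rule derivative_eq_intros refl)+
       (simp add: fun_eq_iff G_def inner_add_left inner_diff_left inner_diff_right inner_commute
          algebra_simps)
  have hc: "isCont (\<lambda>y. q y - l y) y" for y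
    using q' has_derivative_continuous l by (intro continuous_intros) blast+
  have \<phi>low: "ereal (a + c * (norm (y - x))\<^sup>2) \<le> \<phi> y" for y
    using low[of y] unfolding \<phi>_def q_def power2_norm_eq_inner
    by (cases "f y") (auto simp: algebra_simps)
  have \<phi>up: "\<phi> x \<le> ereal (a + \<epsilon>)"
    using up unfolding \<phi>_def q_def by (cases "f x") auto
  \<comment> \<open>The margin 1 puts every point within \<open>R\<close> of \<open>x\<close> in the
    interior, even for \<open>R = 0\<close>.\<close>
  have "cball x (R + 1) \<noteq> {}" using c by simp
  then obtain m where m: "\<And>z. z \<in> cball x (R + 1) \<Longrightarrow> \<phi> m \<le> \<phi> z"
    using lsc_add_continuous_attains_min[OF f hc compact_cball] unfolding \<phi>_def by metis
  \<comment> \<open>If \<open>m\<close> is farther than \<open>R\<close> from \<open>x\<close>, the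
    growth term gives \<open>\<phi> m\<close> at least \<open>a + \<epsilon>\<close>, hence at least
    \<open>\<phi> x\<close>, so \<open>x\<close> itself is a minimiser.\<close>
  define xh where "xh = (if norm (m - x) \<le> R then m else x)"
  have xh: "norm (xh - x) \<le> R" using c by (simp add: xh_def)
  have "\<phi> xh \<le> \<phi> m"
  proof (cases "norm (m - x) \<le> R")
    case False
    then have "c * R\<^sup>2 \<le> c * (norm (m - x))\<^sup>2"
      using c by (intro mult_left_mono power_mono) auto
    then have "ereal (a + \<epsilon>) \<le> ereal (a + c * (norm (m - x))\<^sup>2)" using c by simp
    then have "\<phi> x \<le> \<phi> m" using \<phi>up \<phi>low[of m] by (meson order_trans)
    then show ?thesis using False by (simp add: xh_def)
  qed (simp add: xh_def)
  then have min: "\<phi> xh \<le> \<phi> z" if "z \<in> cball x (R + 1)" for z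
    using m[OF that] by (rule order_trans)
  have "\<phi> xh \<le> ereal (a + \<epsilon>)"
    using min[of x] \<phi>up c by (auto intro: order_trans)
  then have fin: "\<bar>f xh\<bar> \<noteq> \<infinity>"
    using \<phi>low[of xh] unfolding \<phi>_def by (cases "f xh") auto
  have "\<exists>w \<in> limiting_subdiff f xh. norm (w - v) \<le> (\<rho> + 2 * c) * R + L"
    if L: "L \<ge> 0" and lL: "\<forall>\<^sub>F y in at xh. \<bar>l y - l xh\<bar> \<le> L * norm (y - xh)" for L
  proof -
    have "\<forall>\<^sub>F y in nhds xh. y \<in> ball x (R + 1)"
      using xh by (intro eventually_nhds_in_open) (auto simp: dist_norm norm_minus_commute)
    then have "\<forall>\<^sub>F y in at xh. y \<in> ball x (R + 1)"
      by (simp add: eventually_at_filter eventually_mono)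
    \<comment> \<open>Calmness trades the increment of \<open>l\<close> for
      \<open>L * norm (y - xh)\<close>, so \<open>l\<close> drops out.\<close>
    with lL have "\<forall>\<^sub>F y in at xh. f xh + ereal (q xh) \<le> f y + ereal (q y + L * norm (y - xh))"
    proof eventually_elim
      case (elim y)
      have "\<phi> xh \<le> \<phi> y" using elim(2) by (intro min) simp
      then show ?case using elim(1) fin unfolding \<phi>_def
        by (cases "f xh"; cases "f y") auto
    qed
    moreover have "isCont G xh" unfolding G_def by (intro continuous_intros)
    ultimately obtain w where w: "w \<in> limiting_subdiff f xh" "norm (w + G xh) \<le> L"
      using local_min_norm_imp_limiting_subdiff[OF f fin q' _ L] by blast
    have "w - v = (w + G xh) - (\<rho> + 2 * c) *\<^sub>R (xh - x)" by (simp add: G_def)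
    then have "norm (w - v) \<le> norm (w + G xh) + norm ((\<rho> + 2 * c) *\<^sub>R (xh - x))"
      using norm_triangle_ineq4 by metis
    also have "norm ((\<rho> + 2 * c) *\<^sub>R (xh - x)) \<le> (\<rho> + 2 * c) * R"
      using xh \<rho> c by (auto intro!: mult_left_mono)
    finally show ?thesis using w by (intro bexI[of _ w]) auto
  qed
  with xh that show thesis by blast
qed

section \<open>Distances, Lipschitz moduli and the graph constant\<close>

lemma edist_to_le: "q \<in> Q \<Longrightarrow> edist_to x Q \<le> ereal (dist x q)"
  unfolding edist_to_def by (rule INF_lower)

lemma locally_lipschitz_isCont:
  assumes "locally_lipschitz l"
  shows "isCont (\<lambda>y. real_of_ereal (l y)) x"
proof -
  obtain e L where "e > 0" "L-lipschitz_on (ball x e) (\<lambda>y. real_of_ereal (l y))"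
    using assms unfolding locally_lipschitz_def by blast
  then show ?thesis
    by (metis lipschitz_on_continuous_on continuous_on_interior interior_ball centre_in_ball)
qed

lemma lip_nonneg: "lip l z \<ge> 0"
  unfolding lip_def
  by (rule le_Limsup) (auto simp: eventually_at_filter intro!: eventuallyI)

lemma lip_less_imp_eventually_le:
  assumes fin: "\<And>y. \<bar>l y\<bar> \<noteq> \<infinity>" and L: "lip l z < ereal L"
  shows "\<forall>\<^sub>F y in at z. \<bar>real_of_ereal (l y) - real_of_ereal (l z)\<bar> \<le> L * norm (y - z)"
proof -
  have "\<forall>\<^sub>F y in at z. \<bar>l y - l z\<bar> / ereal (norm (y - z)) < ereal L"
    using L unfolding lip_def by (rule Limsup_lessD)
  moreover have "\<forall>\<^sub>F y in at z. y \<noteq> z" by (simp add: eventually_at_filter)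
  ultimately show ?thesis
  proof eventually_elim
    case (elim y)
    then show ?case using fin[of y] fin[of z]
      by (cases "l y"; cases "l z") (auto simp: field_simps)
  qed
qed

text \<open>The left side expands to \<open>(1 + \<rho>\<^sup>2) * R\<^sup>2 + 4 * \<rho> *
  \<epsilon> + 4 * \<epsilon>\<^sup>2 / R\<^sup>2\<close>. The given \<open>R\<close> balances the
  outer terms and so minimises the sum, with value
  \<open>4 * (\<rho> + sqrt (1 + \<rho>\<^sup>2)) * \<epsilon>\<close>.\<close>

lemma gph_distance_bound:
  fixes \<rho> \<epsilon> R :: real
  assumes "\<rho> \<ge> 0" "\<epsilon> > 0" and R: "R\<^sup>2 = 2 * \<epsilon> / sqrt (1 + \<rho>\<^sup>2)"
  shows "R\<^sup>2 + (\<rho> * R + 2 * \<epsilon> / R)\<^sup>2 \<le> 4 * (\<rho> + sqrt (2 + \<rho>\<^sup>2)) * \<epsilon>"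
proof -
  define t where "t = sqrt (1 + \<rho>\<^sup>2)"
  have t: "t > 0" "t\<^sup>2 = 1 + \<rho>\<^sup>2" by (auto simp: t_def add_pos_nonneg)
  have R2: "R\<^sup>2 = 2 * \<epsilon> / t" using R by (simp add: t_def)
  then have "R \<noteq> 0" using assms t by auto
  have "R\<^sup>2 + (\<rho> * R + 2 * \<epsilon> / R)\<^sup>2 = (1 + \<rho>\<^sup>2) * R\<^sup>2 + 4 * \<rho> * \<epsilon> + 4 * \<epsilon>\<^sup>2 / R\<^sup>2"
    using \<open>R \<noteq> 0\<close> by (simp add: power2_sum power_mult_distrib power_divide algebra_simps)
  also have "\<dots> = 4 * (\<rho> + t) * \<epsilon>"
    unfolding R2 t(2)[symmetric] using t(1) assms(2) by (simp add: field_simps power2_eq_square)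
  also have "\<dots> \<le> 4 * (\<rho> + sqrt (2 + \<rho>\<^sup>2)) * \<epsilon>"
    using assms by (auto simp: t_def intro!: mult_right_mono)
  finally show ?thesis .
qed

theorem theorem6p1:
  fixes f g l u :: "'a::euclidean_space \<Rightarrow> ereal"
    and \<rho> :: real and x v :: 'a
  assumes "lsc f" and "lsc g" and "lsc l" and "lsc u"
    and "\<rho> \<ge> 0"
    and "(x, v) \<in> gph_limiting_subdiff g"
    and "locally_lipschitz l"
    and "\<And>y. diff_defined (f y) (g y) \<Longrightarrow> l y \<le> f y - g y \<and> f y - g y \<le> u y"
    and "\<And>y. g y \<ge> g x + ereal (v \<bullet> (y - x) - \<rho> / 2 * (norm (y - x))\<^sup>2)"
  shows "(\<forall>\<gamma>::real. \<gamma> > 0 \<longrightarrow>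
           (\<exists>xh. norm (xh - x) \<le> 2 * \<gamma> \<and>
             edist_to v (limiting_subdiff f xh)
               \<le> ereal (2 * \<rho> * \<gamma>) + (u x - l x) / ereal \<gamma> + lip l xh)) \<and>
         (l constant_on UNIV \<longrightarrow>
           edist_to (x, v) (gph_limiting_subdiff f)
             \<le> ereal (sqrt (4 * (\<rho> + sqrt (2 + \<rho>\<^sup>2)))) * ereal_sqrt (u x - l x))"
proof -
  have gfin: "\<bar>g x\<bar> \<noteq> \<infinity>"
    using assms(6) by (auto simp: gph_limiting_subdiff_def limiting_subdiff_def)
  then obtain gx where gx: "g x = ereal gx" by (cases "g x") auto
  have lfin: "\<bar>l y\<bar> \<noteq> \<infinity>" for y
    using assms(7) by (auto simp: locally_lipschitz_def)
  define lr where "lr y = real_of_ereal (l y)" for y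
  have lr: "l y = ereal (lr y)" for y
    using lfin by (simp add: lr_def ereal_real')
  have lc: "isCont lr y" for y
    unfolding lr_def using locally_lipschitz_isCont[OF assms(7)] .
  \<comment> \<open>Where \<open>f y - g y\<close> is undefined, the quadratic minorant excludes
    \<open>- \<infinity>\<close> for \<open>g y\<close>, so \<open>f y = \<infinity>\<close> and the
    bound is trivial.\<close>
  have low: "ereal (gx + v \<bullet> (y - x) - \<rho> / 2 * (norm (y - x))\<^sup>2 + lr y) \<le> f y" for y
    using assms(8)[of y] assms(9)[of y] unfolding gx lr diff_defined_def
    by (cases "f y"; cases "g y") auto
  have xbounds: "l x \<le> f x - g x \<and> f x - g x \<le> u x"
    using assms(8)[of x] gfin by (auto simp: diff_defined_def)
  show ?thesis
  proof (cases "u x = \<infinity>")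
    \<comment> \<open>Both right-hand sides are infinite and \<open>xh = x\<close> serves. The
      positive square root matters because \<open>0 * \<infinity> = 0\<close> in
      \<open>ereal\<close>.\<close>
    case True
    have "sqrt (4 * (\<rho> + sqrt (2 + \<rho>\<^sup>2))) > 0"
      using assms(5) by (simp add: add_nonneg_pos add_pos_nonneg)
    then have "ereal (sqrt (4 * (\<rho> + sqrt (2 + \<rho>\<^sup>2)))) * ereal_sqrt (u x - l x) = \<infinity>"
      using True lr[of x] by (simp add: ereal_sqrt_def)
    moreover have "ereal (2 * \<rho> * \<gamma>) + (u x - l x) / ereal \<gamma> + lip l x = \<infinity>" if "\<gamma> > 0" for \<gamma>
      using that True lr[of x] by simp
    ultimately show ?thesis
      by (metis diff_self ereal_less_eq(1) less_imp_le mult_2 add_nonneg_nonneg norm_zero)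
  next
    case False
    define \<epsilon> where "\<epsilon> = real_of_ereal (u x) - lr x"
    have ux: "u x = ereal (\<epsilon> + lr x)" and \<epsilon>: "\<epsilon> \<ge> 0" and up: "f x \<le> ereal (gx + lr x + \<epsilon>)"
      using xbounds False unfolding lr gx \<epsilon>_def by (cases "u x"; cases "f x"; auto)+
    have ul: "u x - l x = ereal \<epsilon>" using ux lr by simp
    note point = quadratic_minorant_nearby_subgradient[OF assms(1) lc assms(5) low up]
    have "\<exists>xh. norm (xh - x) \<le> 2 * \<gamma> \<and> edist_to v (limiting_subdiff f xh)
        \<le> ereal (2 * \<rho> * \<gamma>) + (u x - l x) / ereal \<gamma> + lip l xh" if "\<gamma> > 0" for \<gamma>
    proof -
      \<comment> \<open>The least \<open>c\<close> allowed for radius \<open>2 * \<gamma>\<close>;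
        the slope of the penalty at that radius is exactly
        \<open>\<epsilon> / \<gamma>\<close>.\<close>
      define c where "c = \<epsilon> / (4 * \<gamma>\<^sup>2)"
      have c: "c \<ge> 0" "2 * \<gamma> \<ge> 0" "\<epsilon> \<le> c * (2 * \<gamma>)\<^sup>2"
        and ceq: "(\<rho> + 2 * c) * (2 * \<gamma>) = 2 * \<rho> * \<gamma> + \<epsilon> / \<gamma>"
        using \<open>\<gamma> > 0\<close> \<epsilon> by (auto simp: c_def power2_eq_square field_simps)
      obtain xh where xh: "norm (xh - x) \<le> 2 * \<gamma>"
        and w: "\<And>L. L \<ge> 0 \<Longrightarrow> \<forall>\<^sub>F y in at xh. \<bar>lr y - lr xh\<bar> \<le> L * norm (y - xh) \<Longrightarrow>
          \<exists>w \<in> limiting_subdiff f xh. norm (w - v) \<le> (\<rho> + 2 * c) * (2 * \<gamma>) + L"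
        using point[OF c] by blast
      have "edist_to v (limiting_subdiff f xh) \<le> ereal (2 * \<rho> * \<gamma> + \<epsilon> / \<gamma>) + lip l xh"
      proof (cases "lip l xh")
        case (real k)
        then have "k \<ge> 0" using lip_nonneg[of l xh] by simp
        show ?thesis
        \<comment> \<open>Calmness is available only for constants strictly above
          \<open>lip l xh\<close>, hence the slack \<open>d\<close>.\<close>
        proof (rule ereal_le_epsilon2)
          fix d :: real assume "d > 0"
          then have "\<forall>\<^sub>F y in at xh. \<bar>lr y - lr xh\<bar> \<le> (k + d) * norm (y - xh)"
            unfolding lr_def using lfin real by (intro lip_less_imp_eventually_le) auto
          then obtain w where "w \<in> limiting_subdiff f xh"
              "norm (w - v) \<le> (\<rho> + 2 * c) * (2 * \<gamma>) + (k + d)"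
            using w[of "k + d"] \<open>k \<ge> 0\<close> \<open>d > 0\<close> by auto
          then have "edist_to v (limiting_subdiff f xh) \<le> ereal (2 * \<rho> * \<gamma> + \<epsilon> / \<gamma> + (k + d))"
            using edist_to_le[of w] unfolding ceq
            by (metis dist_commute dist_norm ereal_less_eq(3) order_trans)
          then show "edist_to v (limiting_subdiff f xh)
              \<le> ereal (2 * \<rho> * \<gamma> + \<epsilon> / \<gamma>) + lip l xh + ereal d"
            using real by (simp add: add.assoc)
        qed
      qed (use lip_nonneg[of l xh] in auto)
      then show ?thesis using xh \<open>\<gamma> > 0\<close> ul by auto
    qed
    moreover have "edist_to (x, v) (gph_limiting_subdiff f)
             \<le> ereal (sqrt (4 * (\<rho> + sqrt (2 + \<rho>\<^sup>2)))) * ereal_sqrt (u x - l x)"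
      if const: "l constant_on UNIV"
    proof -
      have bound: "edist_to (x, v) (gph_limiting_subdiff f)
          \<le> ereal (sqrt (R\<^sup>2 + ((\<rho> + 2 * c) * R)\<^sup>2))"
        if c: "c \<ge> 0" "R \<ge> 0" "\<epsilon> \<le> c * R\<^sup>2" for c R
      proof -
        obtain xh where xh: "norm (xh - x) \<le> R"
          and w: "\<And>L. L \<ge> 0 \<Longrightarrow> \<forall>\<^sub>F y in at xh. \<bar>lr y - lr xh\<bar> \<le> L * norm (y - xh) \<Longrightarrow>
            \<exists>w \<in> limiting_subdiff f xh. norm (w - v) \<le> (\<rho> + 2 * c) * R + L"
          using point[OF c] by blast
        have "lr y = lr xh" for y
          using const unfolding constant_on_def lr_def by (metis UNIV_I)
        \<comment> \<open>A constant \<open>l\<close> admits \<open>L = 0\<close>.\<close>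
        then obtain w where w: "w \<in> limiting_subdiff f xh" "norm (w - v) \<le> (\<rho> + 2 * c) * R"
          using w[of 0] by auto
        have "dist (x, v) (xh, w) \<le> sqrt (R\<^sup>2 + ((\<rho> + 2 * c) * R)\<^sup>2)"
          using xh w(2) unfolding dist_Pair_Pair
          by (intro real_sqrt_le_mono add_mono power_mono) (auto simp: dist_norm norm_minus_commute)
        moreover have "(xh, w) \<in> gph_limiting_subdiff f"
          using w by (simp add: gph_limiting_subdiff_def)
        ultimately show ?thesis
          using edist_to_le by (meson ereal_less_eq(3) order_trans)
      qed
      have "edist_to (x, v) (gph_limiting_subdiff f) \<le> ereal (sqrt (4 * (\<rho> + sqrt (2 + \<rho>\<^sup>2)) * \<epsilon>))"
      proof (cases "\<epsilon> = 0")
        case True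
        then show ?thesis using bound[of 0 0] by simp
      next
        case False
        then have pos: "\<epsilon> > 0" using \<epsilon> by simp
        define R where "R = sqrt (2 * \<epsilon> / sqrt (1 + \<rho>\<^sup>2))"
        have s: "sqrt (1 + \<rho>\<^sup>2) > 0" by (simp add: add_pos_nonneg)
        have R: "R > 0" "R\<^sup>2 = 2 * \<epsilon> / sqrt (1 + \<rho>\<^sup>2)"
          using pos s by (auto simp: R_def)
        have "edist_to (x, v) (gph_limiting_subdiff f)
            \<le> ereal (sqrt (R\<^sup>2 + ((\<rho> + 2 * (\<epsilon> / R\<^sup>2)) * R)\<^sup>2))"
          using R(1) pos by (intro bound) auto
        also have "(\<rho> + 2 * (\<epsilon> / R\<^sup>2)) * R = \<rho> * R + 2 * \<epsilon> / R"
          using R(1) by (simp add: field_simps power2_eq_square)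
        also have "ereal (sqrt (R\<^sup>2 + (\<rho> * R + 2 * \<epsilon> / R)\<^sup>2)) \<le> ereal (sqrt (4 * (\<rho> + sqrt (2 + \<rho>\<^sup>2)) * \<epsilon>))"
          using gph_distance_bound[OF assms(5) pos R(2)] by simp
        finally show ?thesis .
      qed
      then show ?thesis by (simp add: ul ereal_sqrt_def real_sqrt_mult)
    qed
    ultimately show ?thesis by blast
  qed
qed

end
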